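(* Let $\hat D$ be a co-loopless Le-diagram of type $(k,n)$ with decorated permutation $\hat\pi$, written in one-line notation as $\hat\pi=(a_n,a_1,\dots,a_{n-1})$ (so $\hat\pi(1)=a_n$ and $\hat\pi(i)=a_{i-1}$ for $2\le i\le n$), and let $D$ be the filling produced from $\hat D$ by the algorithm described in the context. Then the decorated permutation associated to $D$ is $\pi=(a_1,a_2,\dots,a_n)$, i.e. $\pi(i)=a_i$ for all $i$, where $\pi$ is loopless and has $k+1$ anti-excedances.
   Context: Le-diagrams. For $0\le k\le n$, a Le-diagram of type $(k,n)$ is a filling of a Young diagram $\lambda$ (English convention, in the top-left corner of a $k\times(n-k)$ rectangle and fitting inside it) with $0$ and $+$ such that no box containing $0$ has both a $+$ above it in its column and a $+$ to its left in its row. The south-east boundary of $\lambda$ is a lattice path of $n$ unit steps from the top-right to the bottom-left corner of the rectangle, with steps labelled $1,\dots,n$ in order; vertical step labels are row labels (rows may have length $0$), horizontal step labels are column labels. Box $(i,j)$ is the box in row $i$, column $j$ (existing only inside $\lambda$, with $i<j$). "Below" = larger row label, "to the left" = larger column label. The decorated permutation of a Le-diagram is read from its pipe dream: each $0$ becomes a crossing, each $+$ an elbow (a pipe entering from the bottom exits left, one entering from the right exits top); north-west boundary ends of rows/columns carry the same labels as the rows/columns; the pipe from boundary step $i$ (moving left from a row label, up from a column label) exits at label $j$, and the permutation sends $i\mapsto j$. A fixed point is a co-loop if it is a row label and a loop if it is a column label. Anti-excedances are the elements $i$ with $\pi^{-1}(i)>i$ or $i$ a co-loop; they are exactly the row labels.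 Loopless/co-loopless means no loops/no co-loops; $\hat D$ co-loopless means every row is nonempty and contains a $+$. The algorithm. Let the row labels of $\hat D$ be $b_1<\dots<b_k$ and $a_n=\hat\pi(1)$. $D$ has the Young-diagram shape of type $(k+1,n)$ with row labels $\{b_1,\dots,b_k,a_n\}$. $L_u$ = column label of the leftmost $+$ in row $b_u$ of $\hat D$; for row $a_n$ set $L=\infty$ and regard its row in $\hat D$ as all $0$'s. $W(r)$ = label of the next row of $D$ below row $r$, or $n+1$ for the last row. A $0$ of $\hat D$ is restricted if some box to its left in its row contains $+$, else unrestricted. For row $r$ and column $\ell$ of $D$: (i) $\hat D$ has $+$ at $(r,\ell)$ (never for $r=a_n$); (ii) some row label $b'>r$ of $\hat D$ has $+$ at $(b',\ell)$ with every box $(b,\ell)$ of $\hat D$, $b$ a row label, $r<b<b'$, containing an unrestricted $0$; (iii) every existing box $(b,\ell)$ of $\hat D$ with $b>r$ a row label contains an unrestricted $0$. Row types: (I) rows $b_u$ with box $(b_u,a_n)$ of $\hat D$ nonexistent or $0$; (II) rows $b_u$ with $+$ at $(b_u,a_n)$; (III) row $a_n$. Type (I)/(III) row $r$ with $L$ and $W=W(r)$: box $(r,\ell)$ gets $+$ if $r<\ell<\min(W,L)$; if $W<\ell<L$, $+$ iff (i), (ii) or (iii) holds, else $0$; $0$ if $\ell\ge L$. Type (II) row $r$: boxes with $\ell<a_n$ follow the type (I) rule; boxes with $\ell>a_n$ get $+$ exactly when $\hat D$ has $+$ at $(r,\ell)$. *)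

theory Defs
  imports Main "HOL-Library.Extended_Nat" "HOL-Combinatorics.Permutations"
begin

(* A Young diagram inside a k x (n-k) rectangle is recorded by the row labels of its south-east
   boundary path, i.e. by the k-subset of {1..n} of vertical steps: the row labelled i and the
   column labelled j meet in a box of the diagram iff i < j.  Rows are ordered from top to bottom
   by increasing label, columns from left to right by decreasing label.  All k-subsets occur, and
   a row may be empty.  The filling is given by the set of boxes that contain a +; every other
   box contains a 0. *)
record diagram =
  rows :: "nat set"
  plus :: "(nat \<times> nat) set"

definition cols :: "nat \<Rightarrow> diagram \<Rightarrow> nat set" where
  "cols n D = {1..n} - rows D"

definition boxes :: "nat \<Rightarrow> diagram \<Rightarrow> (nat \<times> nat) set" where
  "boxes n D = {(i, j). i \<in> rows D \<and> j \<in> cols n D \<and> i < j}"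

definition le_diagram :: "nat \<Rightarrow> nat \<Rightarrow> diagram \<Rightarrow> bool" where
  "le_diagram k n D \<longleftrightarrow>
     rows D \<subseteq> {1..n} \<and> card (rows D) = k \<and> plus D \<subseteq> boxes n D \<and>
     (\<forall>(i, j) \<in> boxes n D - plus D.
        \<not> ((\<exists>i'. i' < i \<and> (i', j) \<in> plus D) \<and> (\<exists>j'. j < j' \<and> (i, j') \<in> plus D)))"

(* Every partition fitting in the rectangle is the sequence of row lengths of such a set. *)
lemma rows_of_partition:
  fixes lam :: "nat \<Rightarrow> nat" and k m :: nat
  assumes anti: "\<And>r s. r \<le> s \<Longrightarrow> s < k \<Longrightarrow> lam s \<le> lam r"
    and bound: "\<And>r. r < k \<Longrightarrow> lam r \<le> m"
  defines "lab \<equiv> \<lambda>r. Suc r + (m - lam r)"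
  defines "B \<equiv> lab ` {..<k}"
  shows "B \<subseteq> {1..k + m}" "card B = k"
    and "\<And>r s. r < s \<Longrightarrow> s < k \<Longrightarrow> lab r < lab s"
    and "\<And>r. r < k \<Longrightarrow> card {j \<in> {1..k + m} - B. lab r < j} = lam r"
proof -
  show mono: "lab r < lab s" if "r < s" "s < k" for r s
    using anti[of r s] that by (simp add: lab_def)
  have inj: "inj_on lab {..<k}"
    by (rule linorder_inj_onI') (use mono in fastforce)
  show sub: "B \<subseteq> {1..k + m}"
    by (auto simp: B_def lab_def)
  show "card B = k"
    using inj by (simp add: B_def card_image)
  show "card {j \<in> {1..k + m} - B. lab r < j} = lam r" if r: "r < k" for r
  proof -
    have iff: "lab r < lab s \<longleftrightarrow> r < s" if "s < k" for s
      using mono[of r s] mono[of s r] that r by (metis linorder_neqE_nat order_less_asym)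
    have lab_le: "lab s \<le> k + m" if "s < k" for s
      using that by (simp add: lab_def)
    have above: "{j \<in> B. lab r < j} = lab ` {r<..<k}"
      using iff by (auto simp: B_def)
    have "{j \<in> {1..k + m} - B. lab r < j} = {lab r<..k + m} - lab ` {r<..<k}"
      using above by (auto simp: lab_def)
    moreover have "card ({lab r<..k + m} - lab ` {r<..<k})
        = card {lab r<..k + m} - card (lab ` {r<..<k})"
      by (rule card_Diff_subset)
        (use mono lab_le in auto)
    moreover have "card (lab ` {r<..<k}) = k - Suc r"
      using inj_on_subset[OF inj, of "{r<..<k}"] by (simp add: card_image subset_iff)
    ultimately show ?thesis
      using bound[OF r] r by (simp add: lab_def)
  qed
qed

(* Pipes.  pipe_left n D i j is the exit label of a pipe that travels left in row i and is about
   to enter the box in the next column whose label exceeds j; pipe_up n D i j is the exit label of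
   a pipe that travels up in column j and is about to enter the box in the next row whose label
   is smaller than i.  A pipe is turned at a + and goes straight at a 0. *)
function pipe_left :: "nat \<Rightarrow> diagram \<Rightarrow> nat \<Rightarrow> nat \<Rightarrow> nat"
  and pipe_up :: "nat \<Rightarrow> diagram \<Rightarrow> nat \<Rightarrow> nat \<Rightarrow> nat" where
  "pipe_left n D i j =
     (if {c \<in> cols n D. j < c} = {} then i
      else let c = Min {c \<in> cols n D. j < c} in
        if (i, c) \<in> plus D then pipe_up n D i c else pipe_left n D i c)"
| "pipe_up n D i j =
     (if {r \<in> rows D. r < i} = {} then j
      else let r = Max {r \<in> rows D. r < i} in
        if (r, j) \<in> plus D then pipe_left n D r j else pipe_up n D r j)"
  by pat_completeness auto
termination
proof -
  have left: "j < x \<and> x \<le> n"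
    if "{c \<in> cols n D. j < c} \<noteq> {}" "x = Min {c \<in> cols n D. j < c}" for n D j x
    using Min_in[OF _ that(1)] that(2) by (auto simp: cols_def)
  have up: "x < i"
    if "{r \<in> rows D. r < i} \<noteq> {}" "x = Max {r \<in> rows D. r < i}" for D and i x :: nat
    using Max_in[OF _ that(1)] that(2) by auto
  let ?m = "\<lambda>(n, D, i, j). i + (n - j)"
  show ?thesis
    apply (relation "measure (case_sum ?m ?m)")
        apply simp
    apply (drule (1) left)
    apply (simp only: in_measure sum.case prod.case)
    apply linarith
    apply (drule (1) left)
    apply (simp only: in_measure sum.case prod.case)
    apply linarith
    apply (drule (1) up)
    apply (simp only: in_measure sum.case prod.case)
    apply (drule (1) up)
    apply (simp only: in_measure sum.case prod.case)
    done
qed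

declare pipe_left.simps [simp del] pipe_up.simps [simp del]

(* A decorated permutation of {1..n}; permutations are extended by the identity outside {1..n}.
   The fixed points in coloops are the co-loops, the other ones are the loops. *)
record decorated_perm =
  perm :: "nat \<Rightarrow> nat"
  coloops :: "nat set"

definition is_decorated_perm :: "nat \<Rightarrow> decorated_perm \<Rightarrow> bool" where
  "is_decorated_perm n p \<longleftrightarrow>
     perm p permutes {1..n} \<and> coloops p \<subseteq> {i \<in> {1..n}. perm p i = i}"

definition loops :: "nat \<Rightarrow> decorated_perm \<Rightarrow> nat set" where
  "loops n p = {i \<in> {1..n}. perm p i = i} - coloops p"

definition anti_excedances :: "nat \<Rightarrow> decorated_perm \<Rightarrow> nat set" where
  "anti_excedances n p = {i \<in> {1..n}. i < inv (perm p) i \<or> i \<in> coloops p}"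

definition diagram_perm :: "nat \<Rightarrow> diagram \<Rightarrow> nat \<Rightarrow> nat" where
  "diagram_perm n D i =
     (if i \<in> rows D then pipe_left n D i i
      else if i \<in> cols n D then pipe_up n D i i
      else i)"

definition decorated_perm_of :: "nat \<Rightarrow> diagram \<Rightarrow> decorated_perm" where
  "decorated_perm_of n D =
     \<lparr>perm = diagram_perm n D, coloops = {i \<in> rows D. diagram_perm n D i = i}\<rparr>"

(* The algorithm.  Below, Dh is the input diagram and a is the new row label. *)

definition unrestricted_zero :: "nat \<Rightarrow> diagram \<Rightarrow> nat \<Rightarrow> nat \<Rightarrow> bool" where
  "unrestricted_zero n Dh b l \<longleftrightarrow>
     (b, l) \<in> boxes n Dh - plus Dh \<and> \<not> (\<exists>l'. l < l' \<and> (b, l') \<in> plus Dh)"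

definition leftmost_plus :: "diagram \<Rightarrow> nat \<Rightarrow> nat \<Rightarrow> enat" where
  "leftmost_plus Dh a r = (if r = a then \<infinity> else enat (Max {l. (r, l) \<in> plus Dh}))"

definition next_row :: "nat \<Rightarrow> diagram \<Rightarrow> nat \<Rightarrow> nat \<Rightarrow> nat" where
  "next_row n Dh a r = Min (insert (n + 1) {b \<in> insert a (rows Dh). r < b})"

definition cond_i :: "diagram \<Rightarrow> nat \<Rightarrow> nat \<Rightarrow> bool" where
  "cond_i Dh r l \<longleftrightarrow> (r, l) \<in> plus Dh"

definition cond_ii :: "nat \<Rightarrow> diagram \<Rightarrow> nat \<Rightarrow> nat \<Rightarrow> bool" where
  "cond_ii n Dh r l \<longleftrightarrow>
     (\<exists>b'\<in>rows Dh. r < b' \<and> (b', l) \<in> plus Dh \<and>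
        (\<forall>b\<in>rows Dh. r < b \<and> b < b' \<longrightarrow> unrestricted_zero n Dh b l))"

definition cond_iii :: "nat \<Rightarrow> diagram \<Rightarrow> nat \<Rightarrow> nat \<Rightarrow> bool" where
  "cond_iii n Dh r l \<longleftrightarrow>
     (\<forall>b\<in>rows Dh. r < b \<and> (b, l) \<in> boxes n Dh \<longrightarrow> unrestricted_zero n Dh b l)"

definition type_I_plus :: "nat \<Rightarrow> diagram \<Rightarrow> nat \<Rightarrow> nat \<Rightarrow> nat \<Rightarrow> bool" where
  "type_I_plus n Dh a r l \<longleftrightarrow>
     (let L = leftmost_plus Dh a r; W = next_row n Dh a r in
        (r < l \<and> enat l < min (enat W) L) \<or>
        (W < l \<and> enat l < L \<and> (cond_i Dh r l \<or> cond_ii n Dh r l \<or> cond_iii n Dh r l)))"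

(* Rows of type (II) are those r with (r, a) in plus Dh. *)
definition algorithm_plus :: "nat \<Rightarrow> diagram \<Rightarrow> nat \<Rightarrow> nat \<Rightarrow> nat \<Rightarrow> bool" where
  "algorithm_plus n Dh a r l \<longleftrightarrow>
     (if (r, a) \<in> plus Dh \<and> a < l then (r, l) \<in> plus Dh else type_I_plus n Dh a r l)"

definition algorithm :: "nat \<Rightarrow> diagram \<Rightarrow> diagram" where
  "algorithm n Dh =
     (let a = perm (decorated_perm_of n Dh) 1; R = insert a (rows Dh) in
        \<lparr>rows = R,
         plus = {(r, l). (r, l) \<in> boxes n \<lparr>rows = R, plus = {}\<rparr> \<and> algorithm_plus n Dh a r l}\<rparr>)"

end

(* Cut both pipe dreams above all rows with label at least m and compare the exit labels carried
   upwards by the columns that cross the cut.  Conditions (i)-(iii) together say that a column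
   meets no restricted 0 further down; call such a column good.  In a column that is not good
   everything above the cut is 0, by the Le condition, in Dh and in D, so its pipe goes straight
   up.  Down to row a, the columns to the left of column a carry the same values in Dh and in D,
   while the value of D in a good column to the right of a is the value of Dh in the next good
   column to its left.  Below row a this shift affects all good columns, and the leftmost one
   carries a in D.  Hence the value leaving D at step m is the one of Dh in the rightmost good
   column at the cut m + 1, and this is what leaves Dh at step m + 1. *)

theory Submission
  imports Defs
begin

section \<open>Tracing pipes from one \<open>+\<close> to the next\<close>

text \<open>Zeros are passed straight, so only the set of \<open>+\<close> entries ahead matters. In
  this form rows of \<open>Dh\<close> and \<open>D\<close> can be compared although \<open>D\<close>
  lacks the column \<open>a\<close>.\<close>

lemma pipe_left_eq:
  assumes "plus D \<subseteq> boxes n D"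
  shows "pipe_left n D i j =
    (if {c. (i, c) \<in> plus D \<and> j < c} = {} then i
     else pipe_up n D i (Min {c. (i, c) \<in> plus D \<and> j < c}))"
proof (induction "n - j" arbitrary: j rule: less_induct)
  case less
  let ?C = "{c \<in> cols n D. j < c}" and ?P = "{c. (i, c) \<in> plus D \<and> j < c}"
  have fin: "finite ?C" by (simp add: cols_def)
  have sub: "?P \<subseteq> ?C" using assms by (auto simp: boxes_def)
  show ?case
  proof (cases "?C = {}")
    case True
    then show ?thesis using sub by (subst pipe_left.simps) auto
  next
    case False
    define c where "c = Min ?C"
    have c: "c \<in> cols n D" "j < c" using Min_in[OF fin False] by (auto simp: c_def)
    have le: "c \<le> c'" if "c' \<in> ?P" for c'
      using that sub fin by (auto simp: c_def)
    have step: "pipe_left n D i j =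
        (if (i, c) \<in> plus D then pipe_up n D i c else pipe_left n D i c)"
      by (subst pipe_left.simps) (simp only: False c_def Let_def if_False)
    show ?thesis
    proof (cases "(i, c) \<in> plus D")
      case True
      then have "Min ?P = c"
        using le c finite_subset[OF sub fin] by (intro Min_eqI) auto
      moreover have "?P \<noteq> {}" using True c by auto
      ultimately show ?thesis using step True by (simp only: if_True if_False)
    next
      case no: False
      have eq: "?P = {c'. (i, c') \<in> plus D \<and> c < c'}"
        using le no c by (auto simp: less_le)
      have "n - c < n - j" using c by (auto simp: cols_def)
      from less.hyps[OF this] show ?thesis using step no unfolding eq by (simp only: if_False)
    qed
  qed
qed

text \<open>Cuts are indexed by all labels, not only by row labels. A label that is no row changes
  nothing, so \<open>Dh\<close> and \<open>D\<close>, whose row sets differ, can be followed in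
  parallel.\<close>

lemma pipe_up_Suc:
  assumes "plus D \<subseteq> boxes n D"
  shows "pipe_up n D (Suc m) c =
    (if (m, c) \<in> plus D then pipe_left n D m c else pipe_up n D m c)"
proof (cases "m \<in> rows D")
  case True
  have "Max {r \<in> rows D. r < Suc m} = m"
    using True by (intro Max_eqI) auto
  moreover have "{r \<in> rows D. r < Suc m} \<noteq> {}" using True by auto
  ultimately show ?thesis by (subst pipe_up.simps) (simp only: Let_def if_False)
next
  case False
  then have eq: "{r \<in> rows D. r < Suc m} = {r \<in> rows D. r < m}"
    by (auto simp: less_Suc_eq)
  have "pipe_up n D (Suc m) c = pipe_up n D m c"
    unfolding pipe_up.simps[of n D "Suc m" c] pipe_up.simps[of n D m c] eq ..
  moreover have "(m, c) \<notin> plus D" using False assms by (auto simp: boxes_def)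
  ultimately show ?thesis by simp
qed

lemma pipe_up_0: "pipe_up n D 0 c = c"
  by (subst pipe_up.simps) simp

lemma pipe_up_without_plus:
  assumes "plus D \<subseteq> boxes n D" "\<And>r. r < m \<Longrightarrow> (r, c) \<notin> plus D"
  shows "pipe_up n D m c = c"
  using assms(2) by (induction m) (simp_all add: pipe_up_0 pipe_up_Suc[OF assms(1)])

lemma pipe_left_eq_row:
  assumes "plus D \<subseteq> boxes n D" "\<And>c. j < c \<Longrightarrow> (i, c) \<notin> plus D"
  shows "pipe_left n D i j = i"
  using assms(2) by (subst pipe_left_eq[OF assms(1)]) auto

lemma pipe_left_eq_pipe_up:
  assumes "plus D \<subseteq> boxes n D" "(i, c) \<in> plus D" "j < c"
    and "\<And>c'. (i, c') \<in> plus D \<Longrightarrow> j < c' \<Longrightarrow> c \<le> c'"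
  shows "pipe_left n D i j = pipe_up n D i c"
proof -
  let ?P = "{c. (i, c) \<in> plus D \<and> j < c}"
  have "finite ?P"
    by (rule finite_subset[of _ "{1..n}"]) (use assms(1) in \<open>auto simp: boxes_def cols_def\<close>)
  then have "Min ?P = c" using assms by (intro Min_eqI) auto
  moreover have "?P \<noteq> {}" using assms by blast
  ultimately show ?thesis by (simp only: pipe_left_eq[OF assms(1), of i j] if_False)
qed

lemma Min_plus_in:
  assumes "plus D \<subseteq> boxes n D" "(i, c') \<in> plus D" "j < c'"
  shows "(i, Min {c. (i, c) \<in> plus D \<and> j < c}) \<in> plus D"
    and "j < Min {c. (i, c) \<in> plus D \<and> j < c}"
    and "Min {c. (i, c) \<in> plus D \<and> j < c} \<le> c'"
proof -
  let ?P = "{c. (i, c) \<in> plus D \<and> j < c}"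
  have fin: "finite ?P"
    by (rule finite_subset[of _ "{1..n}"]) (use assms(1) in \<open>auto simp: boxes_def cols_def\<close>)
  moreover have c': "c' \<in> ?P" using assms by simp
  ultimately have "Min ?P \<in> ?P" by (intro Min_in) auto
  then show "(i, Min ?P) \<in> plus D" "j < Min ?P" by auto
  show "Min ?P \<le> c'" using fin c' by simp
qed

section \<open>Pipe permutations of arbitrary fillings and their anti-excedances\<close>

text \<open>Pipes move only left and up. Which of the bounds are strict later separates true
  excedances and anti-excedances from fixed points.\<close>

lemma pipe_exit:
  assumes "plus D \<subseteq> boxes n D"
  shows pipe_left_exit: "i \<in> rows D \<Longrightarrow>
      pipe_left n D i j \<in> {r \<in> rows D. r \<le> i} \<union> {c \<in> cols n D. j < c}"
    and pipe_up_exit: "j \<in> cols n D \<Longrightarrow>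
      pipe_up n D i j \<in> {r \<in> rows D. r < i} \<union> {c \<in> cols n D. j \<le> c}"
proof -
  \<comment> \<open>A turn in row \<open>i\<close> continues with \<open>pipe_up\<close> at the same
    \<open>i\<close>, so the horizontal bound follows from the vertical one. This reduces the mutual
    recursion to an induction on \<open>i\<close>.\<close>
  have left: "pipe_left n D i j \<in> {r \<in> rows D. r \<le> i} \<union> {c \<in> cols n D. j < c}"
    if up: "\<And>j. j \<in> cols n D \<Longrightarrow>
        pipe_up n D i j \<in> {r \<in> rows D. r < i} \<union> {c \<in> cols n D. j \<le> c}"
      and "i \<in> rows D" for i j
  proof (cases "{c. (i, c) \<in> plus D \<and> j < c} = {}")
    case True
    then show ?thesis using \<open>i \<in> rows D\<close> by (subst pipe_left_eq[OF assms]) simp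
  next
    case False
    let ?c = "Min {c. (i, c) \<in> plus D \<and> j < c}"
    have "(i, ?c) \<in> plus D" "j < ?c" using False Min_plus_in[OF assms] by blast+
    then show ?thesis
      using False up[of ?c] assms by (subst pipe_left_eq[OF assms]) (auto simp: boxes_def)
  qed
  have up: "pipe_up n D i j \<in> {r \<in> rows D. r < i} \<union> {c \<in> cols n D. j \<le> c}"
    if "j \<in> cols n D" for i j
    using that
  proof (induction i arbitrary: j)
    case 0
    then show ?case by (simp add: pipe_up_0)
  next
    case (Suc i)
    have "i \<in> rows D" if "(i, j) \<in> plus D" using that assms by (auto simp: boxes_def)
    then show ?case
      using left[OF Suc.IH, of j] Suc.IH[OF Suc.prems] Suc.prems
      by (auto simp: pipe_up_Suc[OF assms])
  qed
  show "j \<in> cols n D \<Longrightarrow>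
      pipe_up n D i j \<in> {r \<in> rows D. r < i} \<union> {c \<in> cols n D. j \<le> c}"
    by (rule up)
  show "i \<in> rows D \<Longrightarrow>
      pipe_left n D i j \<in> {r \<in> rows D. r \<le> i} \<union> {c \<in> cols n D. j < c}"
    using left up by blast
qed

text \<open>Cutting the pipe dream above the rows with label at least \<open>m\<close> leaves the exit labels of the
  steps before \<open>m\<close> and of the columns that reach the cut.  Row \<open>m\<close> rotates these values cyclically
  along its \<open>+\<close> entries, which keeps them distinct.\<close>

lemma cut_inj:
  assumes sub: "plus D \<subseteq> boxes n D" and rows: "rows D \<subseteq> {1..n}" and "m \<le> n"
  shows "inj_on (\<lambda>i. if i \<le> m then diagram_perm n D i else pipe_up n D (Suc m) i)
    ({1..m} \<union> {c \<in> cols n D. m < c})"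
  using \<open>m \<le> n\<close>
proof (induction m)
  case 0
  have "pipe_up n D (Suc 0) c = c" for c
    using sub rows by (intro pipe_up_without_plus[OF sub]) (auto simp: boxes_def)
  then show ?case by (auto simp: inj_on_def)
next
  case (Suc m)
  let ?h = "\<lambda>m i. if i \<le> m then diagram_perm n D i else pipe_up n D (Suc m) i"
  let ?S = "\<lambda>m. {1..m} \<union> {c \<in> cols n D. m < c}"
  let ?m = "Suc m"
  have IH: "inj_on (?h m) (?S m)" using Suc by simp
  show ?case
  proof (cases "?m \<in> rows D")
    case False
    then have m: "?m \<in> cols n D" using Suc.prems by (simp add: cols_def)
    have "(?m, c) \<notin> plus D" for c using False sub by (auto simp: boxes_def)
    then have "?h ?m i = ?h m i" for i
      using m False by (auto simp: pipe_up_Suc[OF sub] diagram_perm_def le_Suc_eq)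
    moreover have "?S ?m = ?S m" using m by (auto simp: le_less Suc_le_eq less_Suc_eq)
    ultimately show ?thesis using IH by simp
  next
    case True
    \<comment> \<open>The new values factor as \<open>g\<close> after \<open>s\<close>:
      \<open>s\<close> is the cyclic rotation of the positions \<open>?m\<close> and the
      \<open>+\<close> columns of the row, and \<open>g\<close> gives the values above the row, with
      position \<open>?m\<close> standing for the left end of the row.\<close>
    define P where "P x = {c. (?m, c) \<in> plus D \<and> x < c}" for x
    define moved where "moved x \<longleftrightarrow> x = ?m \<or> (?m, x) \<in> plus D" for x
    define nxt where "nxt x = (if P x = {} then ?m else Min (P x))" for x
    define s where "s x = (if moved x then nxt x else x)" for x
    define g where "g x = (if x = ?m then ?m else ?h m x)" for x
    have nxt: "P x = {} \<and> nxt x = ?m \<or> (?m, nxt x) \<in> plus D \<and> x < nxt x \<and> (\<forall>y\<in>P x. nxt x \<le> y)"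
      for x
      using Min_plus_in[OF sub, of ?m _ x] by (auto simp: nxt_def P_def)
    have plusD: "c \<in> cols n D \<and> ?m < c" if "(?m, c) \<in> plus D" for c
      using that sub by (auto simp: boxes_def)
    have h: "?h ?m x = g (s x)" if "x \<in> ?S ?m" for x
    proof -
      have left: "pipe_left n D ?m x = g (nxt x)" if "?m \<le> x"
      proof -
        have "P x = {} \<or> ?m < Min (P x)"
          using nxt[of x] that by (auto simp: nxt_def split: if_splits)
        then show ?thesis
          unfolding pipe_left_eq[OF sub, of ?m x] P_def[symmetric] nxt_def g_def by auto
      qed
      consider "x = ?m" | "x \<le> m" | "x \<in> cols n D" "?m < x" using \<open>x \<in> ?S ?m\<close> by force
      then show ?thesis
      proof cases
        case 1
        then show ?thesis using True left by (simp add: s_def moved_def diagram_perm_def)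
      next
        case 2
        then have "\<not> moved x" using plusD[of x] by (auto simp: moved_def)
        then show ?thesis using 2 by (simp add: s_def g_def)
      next
        case 3
        then show ?thesis
          using left by (auto simp: s_def g_def moved_def pipe_up_Suc[OF sub, of ?m])
      qed
    qed
    have s_in: "s x \<in> ?S ?m" if "x \<in> ?S ?m" for x
      using nxt[of x] plusD[of "nxt x"] that by (auto simp: s_def)
    have inj_s: "inj_on s (?S ?m)"
    proof (rule linorder_inj_onI')
      fix x y assume xy: "x \<in> ?S ?m" "y \<in> ?S ?m" "x < y"
      have moved_nxt: "moved (nxt z)" for z using nxt[of z] by (auto simp: moved_def)
      show "s x \<noteq> s y"
      proof (cases "moved x \<and> moved y")
        case True
        then have "y \<in> P x" "?m \<le> x" using xy plusD[of x] by (auto simp: moved_def P_def)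
        then have "x < nxt x" "nxt x \<le> y" using nxt[of x] by auto
        then have "nxt x \<noteq> nxt y" using nxt[of y] \<open>?m \<le> x\<close> by auto
        then show ?thesis using True by (simp add: s_def)
      next
        case False
        then show ?thesis using moved_nxt[of x] moved_nxt[of y] xy(3) by (auto simp: s_def)
      qed
    qed
    have inj_g: "inj_on g (?S ?m)"
    proof -
      \<comment> \<open>The exit \<open>?m\<close> is reached only along row \<open>?m\<close>
        itself, never from above that row.\<close>
      have ne: "?h m x \<noteq> ?m" if "x \<in> ?S m" "x \<noteq> ?m" for x
      proof (cases "x \<le> m")
        case le: True
        have "x \<in> rows D \<or> x \<in> cols n D" using that le Suc.prems by (auto simp: cols_def)
        then show ?thesis
          using le True pipe_left_exit[OF sub, of x x] pipe_up_exit[OF sub, of x x]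
          by (auto simp: diagram_perm_def cols_def)
      next
        case False
        then show ?thesis
          using that True pipe_up_exit[OF sub, of x ?m] by (auto simp: cols_def)
      qed
      have "?S ?m - {?m} \<subseteq> ?S m" by auto
      then have "inj_on (?h m) (?S ?m - {?m})" using IH inj_on_subset by blast
      then have "inj_on g (?S ?m - {?m})" by (simp add: inj_on_def g_def)
      moreover have "g ?m \<notin> g ` (?S ?m - {?m})"
      proof
        assume "g ?m \<in> g ` (?S ?m - {?m})"
        then obtain x where x: "g ?m = g x" "x \<in> ?S ?m - {?m}" by (elim imageE)
        then have "x \<noteq> ?m" "x \<in> ?S m" using \<open>?S ?m - {?m} \<subseteq> ?S m\<close> by blast+
        then have "?h m x = ?m" using x(1) by (simp only: g_def if_False if_True simp_thms)
        then show False using ne[of x] \<open>x \<noteq> ?m\<close> \<open>x \<in> ?S m\<close> by blast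
      qed
      ultimately have "inj_on g (insert ?m (?S ?m - {?m}))"
        by (simp only: inj_on_insert Diff_idemp simp_thms)
      moreover have "insert ?m (?S ?m - {?m}) = ?S ?m" by auto
      ultimately show ?thesis by (simp only:)
    qed
    have "inj_on (\<lambda>x. g (s x)) (?S ?m)"
      using inj_s inj_g s_in unfolding inj_on_def by blast
    then show ?thesis using h unfolding inj_on_def by simp
  qed
qed

text \<open>No column crosses the cut \<open>n\<close>, so there \<open>cut_inj\<close> speaks of
  the permutation alone; finiteness then gives surjectivity.\<close>

lemma diagram_perm_permutes:
  assumes sub: "plus D \<subseteq> boxes n D" and rows: "rows D \<subseteq> {1..n}"
  shows "diagram_perm n D permutes {1..n}"
proof (rule bij_imp_permutes)
  have "inj_on (\<lambda>i. if i \<le> n then diagram_perm n D i else pipe_up n D (Suc n) i) {1..n}"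
    using cut_inj[OF sub rows order_refl] by (rule inj_on_subset) blast
  then have inj: "inj_on (diagram_perm n D) {1..n}"
    by (rule inj_on_cong[THEN iffD1, rotated]) simp
  have "diagram_perm n D ` {1..n} \<subseteq> {1..n}"
  proof
    fix y assume "y \<in> diagram_perm n D ` {1..n}"
    then obtain x where x: "x \<in> {1..n}" "y = diagram_perm n D x" by blast
    then have "x \<in> rows D \<or> x \<in> cols n D" by (auto simp: cols_def)
    then have "y \<in> rows D \<union> cols n D"
      using x pipe_left_exit[OF sub, of x x] pipe_up_exit[OF sub, of x x]
      by (auto simp: diagram_perm_def)
    then show "y \<in> {1..n}" using rows by (auto simp: cols_def)
  qed
  then show "bij_betw (diagram_perm n D) {1..n} {1..n}"
    using inj endo_inj_surj[OF finite_atLeastAtMost] unfolding bij_betw_def by blast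
  show "diagram_perm n D i = i" if "i \<notin> {1..n}" for i
    using that rows by (auto simp: diagram_perm_def cols_def)
qed

lemma diagram_perm_exit_row:
  assumes "plus D \<subseteq> boxes n D" "i \<in> {1..n}" "diagram_perm n D i \<in> rows D"
  shows "diagram_perm n D i < i \<or> diagram_perm n D i = i \<and> i \<in> rows D"
  using assms pipe_left_exit[OF assms(1), of i i] pipe_up_exit[OF assms(1), of i i]
  by (auto simp: diagram_perm_def cols_def split: if_splits)

lemma diagram_perm_exit_col:
  assumes "plus D \<subseteq> boxes n D" "i \<in> {1..n}" "diagram_perm n D i \<notin> rows D"
  shows "i < diagram_perm n D i \<or> diagram_perm n D i = i \<and> i \<notin> rows D"
  using assms pipe_left_exit[OF assms(1), of i i] pipe_up_exit[OF assms(1), of i i]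
  by (auto simp: diagram_perm_def cols_def split: if_splits)

lemma anti_excedances_decorated_perm_of:
  assumes sub: "plus D \<subseteq> boxes n D" and rows: "rows D \<subseteq> {1..n}"
  shows "anti_excedances n (decorated_perm_of n D) = rows D"
proof -
  let ?p = "diagram_perm n D"
  have perm: "?p permutes {1..n}" by (rule diagram_perm_permutes[OF assms])
  have "i \<in> anti_excedances n (decorated_perm_of n D) \<longleftrightarrow> i \<in> rows D" if i: "i \<in> {1..n}" for i
  proof -
    have j: "inv ?p i \<in> {1..n}" "?p (inv ?p i) = i"
      using i permutes_in_image[OF permutes_inv[OF perm], of i] permutes_inverses(1)[OF perm]
      by blast+
    have anti: "i \<in> anti_excedances n (decorated_perm_of n D) \<longleftrightarrow>
        i < inv ?p i \<or> i \<in> rows D \<and> ?p i = i"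
      using i by (simp add: anti_excedances_def decorated_perm_of_def)
    show ?thesis
    proof (cases "i \<in> rows D")
      case True
      then show ?thesis
        using diagram_perm_exit_row[OF sub j(1)] j(2) anti by metis
    next
      case False
      then show ?thesis
        using diagram_perm_exit_col[OF sub j(1)] j(2) anti by (metis less_asym less_irrefl)
    qed
  qed
  moreover have "anti_excedances n (decorated_perm_of n D) \<subseteq> {1..n}"
    by (auto simp: anti_excedances_def)
  ultimately show ?thesis using rows by (meson subset_antisym subset_iff)
qed

section \<open>Good columns of a co-loopless Le-diagram\<close>

definition restricted_zero :: "nat \<Rightarrow> diagram \<Rightarrow> nat \<Rightarrow> nat \<Rightarrow> bool" where
  "restricted_zero n D b c \<longleftrightarrow>
     (b, c) \<in> boxes n D \<and> (b, c) \<notin> plus D \<and> (\<exists>c'>c. (b, c') \<in> plus D)"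

text \<open>With \<open>m \<le> c\<close> instead of a strict bound, a column that starts at step
  \<open>m\<close> already belongs to the cut \<open>m\<close>, where its pipe enters.\<close>

definition good_cols :: "nat \<Rightarrow> diagram \<Rightarrow> nat \<Rightarrow> nat set" where
  "good_cols n D m = {c \<in> cols n D. m \<le> c \<and> (\<forall>b\<ge>m. \<not> restricted_zero n D b c)}"

locale coloopless_le_diagram =
  fixes k n :: nat and Dh :: diagram
  assumes n_pos: "n \<ge> 1"
    and le: "le_diagram k n Dh"
    and coloopless: "coloops (decorated_perm_of n Dh) = {}"
begin

definition a :: nat where "a = diagram_perm n Dh 1"

definition D :: diagram where "D = algorithm n Dh"

text \<open>The finite part of \<open>leftmost_plus\<close>; the infinite value in row
  \<open>a\<close> turns into a separate disjunct \<open>r = a\<close>. For rows of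
  \<open>Dh\<close> the maximum is taken over a nonempty set by \<open>row_nonempty\<close>.\<close>

definition L :: "nat \<Rightarrow> nat" where "L r = Max {c. (r, c) \<in> plus Dh}"

abbreviation G :: "nat \<Rightarrow> nat set" where "G m \<equiv> good_cols n Dh m"

lemma rows_Dh: "rows Dh \<subseteq> {1..n}" and card_rows_Dh: "card (rows Dh) = k"
  and plus_Dh: "plus Dh \<subseteq> boxes n Dh"
  using le unfolding le_diagram_def by blast+

lemma finite_rows_Dh: "finite (rows Dh)"
  using rows_Dh finite_subset by blast

lemma plus_DhD: "r \<in> rows Dh" "c \<in> cols n Dh" "r < c" "1 \<le> r" "c \<le> n" if "(r, c) \<in> plus Dh"
proof -
  have "(r, c) \<in> boxes n Dh" using that plus_Dh by blast
  then show "r \<in> rows Dh" "c \<in> cols n Dh" "r < c" "1 \<le> r" "c \<le> n"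
    using rows_Dh by (auto simp: boxes_def cols_def)
qed

lemma no_plus_above: "(r, c) \<notin> plus Dh" if "restricted_zero n Dh b c" "r < b"
proof -
  have "\<forall>(b, c) \<in> boxes n Dh - plus Dh.
      \<not> ((\<exists>r<b. (r, c) \<in> plus Dh) \<and> (\<exists>c'>c. (b, c') \<in> plus Dh))"
    using le unfolding le_diagram_def by (elim conjE)
  from bspec[OF this, of "(b, c)"] show ?thesis
    using that unfolding restricted_zero_def by auto
qed

text \<open>In a row of zeros the pipe runs straight to the left end, which would make the row label
  a co-loop.\<close>

lemma row_nonempty:
  assumes "r \<in> rows Dh" shows "\<exists>c. (r, c) \<in> plus Dh"
proof (rule ccontr)
  assume "\<not> ?thesis"
  then have "pipe_left n Dh r r = r" by (subst pipe_left_eq[OF plus_Dh]) simp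
  then have "r \<in> coloops (decorated_perm_of n Dh)"
    using assms by (simp add: decorated_perm_of_def diagram_perm_def)
  then show False using coloopless by simp
qed

lemma finite_plus_row: "finite {c. (r, c) \<in> plus Dh}"
  by (rule finite_subset[of _ "{1..n}"]) (auto dest: plus_DhD(2) simp: cols_def)

lemma L_plus: "r \<in> rows Dh \<Longrightarrow> (r, L r) \<in> plus Dh"
  using Max_in[OF finite_plus_row[of r]] row_nonempty[of r] by (auto simp: L_def)

lemma le_L: "(r, c) \<in> plus Dh \<Longrightarrow> c \<le> L r"
  using finite_plus_row by (auto simp: L_def)

lemma restricted_zero_iff:
  assumes "r \<in> rows Dh" "c \<in> cols n Dh" "r < c"
  shows "restricted_zero n Dh r c \<longleftrightarrow> c < L r \<and> (r, c) \<notin> plus Dh"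
proof -
  have "(\<exists>c'>c. (r, c') \<in> plus Dh) \<longleftrightarrow> c < L r"
    using L_plus[OF assms(1)] le_L[of r] less_le_trans[of c _ "L r"] by blast
  then show ?thesis using assms by (auto simp: restricted_zero_def boxes_def)
qed

lemma good_cols_iff: "c \<in> G m \<longleftrightarrow>
    c \<in> cols n Dh \<and> m \<le> c \<and> (\<forall>b\<ge>m. \<not> restricted_zero n Dh b c)"
  by (simp add: good_cols_def)

lemma finite_good_cols: "finite (G m)"
  by (rule finite_subset[of _ "{1..n}"]) (auto simp: good_cols_iff cols_def)

text \<open>By the Le condition a \<open>+\<close> excludes restricted zeros further down in its
  column.\<close>

lemma plus_good:
  assumes "(r, c) \<in> plus Dh" "r \<le> m" "m \<le> c" shows "c \<in> G m"
proof -
  have "\<not> restricted_zero n Dh b c" if "m \<le> b" for b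
  proof (cases "b = r")
    case True
    then show ?thesis using assms(1) by (simp add: restricted_zero_def)
  next
    case False
    then show ?thesis using no_plus_above[of b c r] assms(1,2) that by auto
  qed
  then show ?thesis using assms plus_DhD(2) by (auto simp: good_cols_iff)
qed

text \<open>Crossing row \<open>r\<close> upwards removes the columns with a restricted zero in that
  row: up to \<open>L r\<close> only its \<open>+\<close> entries survive, beyond \<open>L r\<close>
  nothing changes.\<close>

lemma good_cols_row:
  assumes "r \<in> rows Dh"
  shows "c \<in> G r \<longleftrightarrow> (r, c) \<in> plus Dh \<or> (L r < c \<and> c \<in> G (Suc r))"
proof
  assume c: "c \<in> G r"
  then have "c \<noteq> r" using assms by (auto simp: good_cols_iff cols_def)
  then have "r < c" "c \<in> G (Suc r)" using c by (auto simp: good_cols_iff)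
  moreover have "\<not> restricted_zero n Dh r c" "c \<in> cols n Dh" using c by (auto simp: good_cols_iff)
  ultimately show "(r, c) \<in> plus Dh \<or> (L r < c \<and> c \<in> G (Suc r))"
    using restricted_zero_iff[OF assms] L_plus[OF assms] by (metis linorder_neqE_nat)
next
  assume "(r, c) \<in> plus Dh \<or> (L r < c \<and> c \<in> G (Suc r))"
  then show "c \<in> G r"
  proof
    assume "(r, c) \<in> plus Dh"
    then show ?thesis using plus_good plus_DhD(3) by (simp add: less_imp_le)
  next
    assume c: "L r < c \<and> c \<in> G (Suc r)"
    then have "\<not> restricted_zero n Dh r c"
      using restricted_zero_iff[OF assms] by (auto simp: good_cols_iff)
    then have "\<not> restricted_zero n Dh b c" if "r \<le> b" for b
      using c that by (cases "b = r") (auto simp: good_cols_iff)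
    then show ?thesis using c by (auto simp: good_cols_iff)
  qed
qed

lemma good_cols_not_row:
  assumes "m \<notin> rows Dh"
  shows "c \<in> G m \<longleftrightarrow> c \<in> G (Suc m) \<or> (c = m \<and> m \<in> cols n Dh)"
proof -
  have "\<not> restricted_zero n Dh m c" for c
    using assms by (simp add: restricted_zero_def boxes_def)
  moreover have "\<not> restricted_zero n Dh b m" if "b \<ge> m" for b
    using that by (simp add: restricted_zero_def boxes_def)
  ultimately show ?thesis
    by (auto simp: good_cols_iff le_less Suc_le_eq) (metis Suc_leI le_less)+
qed

lemma pipe_up_bad:
  assumes "c \<in> cols n Dh" "m \<le> c" "c \<notin> G m"
  shows "pipe_up n Dh m c = c"
proof (rule pipe_up_without_plus[OF plus_Dh])
  from assms obtain b where "b \<ge> m" "restricted_zero n Dh b c" by (auto simp: good_cols_iff)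
  then show "(r, c) \<notin> plus Dh" if "r < m" for r using that no_plus_above by fastforce
qed

text \<open>The pipe entering at \<open>1\<close> turns at the rightmost \<open>+\<close> of the top row and leaves at the top of
  that column, the column labelled \<open>a\<close>.\<close>

lemma first_row: "a = 1 \<and> 1 \<notin> rows Dh \<or>
    1 \<in> rows Dh \<and> (1, a) \<in> plus Dh \<and> (\<forall>c. (1, c) \<in> plus Dh \<longrightarrow> a \<le> c)"
proof (cases "1 \<in> rows Dh")
  case False
  then have "pipe_up n Dh 1 1 = 1"
    by (intro pipe_up_without_plus[OF plus_Dh]) (auto dest: plus_DhD(4))
  then show ?thesis using False by (auto simp: a_def diagram_perm_def)
next
  case True
  then obtain c where c: "(1, c) \<in> plus Dh" using row_nonempty by blast
  then have ne: "{c. (1, c) \<in> plus Dh \<and> 1 < c} \<noteq> {}" using plus_DhD by blast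
  have "pipe_up n Dh 1 x = x" for x
    by (intro pipe_up_without_plus[OF plus_Dh]) (auto dest: plus_DhD(4))
  then have "a = Min {c. (1, c) \<in> plus Dh \<and> 1 < c}"
    using True ne by (simp only: a_def diagram_perm_def pipe_left_eq[OF plus_Dh, of 1 1] if_False if_True)
  then show ?thesis
    using True Min_plus_in[OF plus_Dh, of 1 _ 1] c plus_DhD by metis
qed

lemma a_col: "a \<in> cols n Dh"
  using first_row plus_DhD(2) n_pos by (auto simp: cols_def)

lemma a_bounds: "1 \<le> a" "a \<le> n" and a_notin_rows: "a \<notin> rows Dh"
  using a_col by (auto simp: cols_def)

text \<open>Column \<open>a\<close> is column 1, which has no boxes, or it has a \<open>+\<close> in
  the top row, and then the Le condition excludes restricted zeros below.\<close>

lemma a_good: "m \<le> a \<Longrightarrow> a \<in> G m"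
proof (cases "a = 1")
  case True
  then show "m \<le> a \<Longrightarrow> a \<in> G m"
    using rows_Dh a_col by (auto simp: good_cols_iff restricted_zero_def boxes_def)
next
  case False
  then have p: "(1, a) \<in> plus Dh" using first_row by blast
  have "\<not> restricted_zero n Dh b a" for b
  proof
    assume z: "restricted_zero n Dh b a"
    then have "b \<noteq> 1" "1 \<le> b" using p rows_Dh by (auto simp: restricted_zero_def boxes_def)
    then show False using no_plus_above[OF z, of 1] p by simp
  qed
  then show "m \<le> a \<Longrightarrow> a \<in> G m" using a_col by (auto simp: good_cols_iff)
qed

text \<open>Since column \<open>a\<close> is good, a zero in it is unrestricted. Thus a type (I) row
  that meets column \<open>a\<close> has all its \<open>+\<close> entries to the right of
  it.\<close>

lemma L_less_a:
  assumes "r \<in> rows Dh" "r < a" "(r, a) \<notin> plus Dh" shows "L r < a"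
proof -
  have "a \<in> G r" using a_good assms(2) by simp
  then show ?thesis using good_cols_row[OF assms(1)] assms(3) by blast
qed

section \<open>The filling \<open>D\<close> in terms of good columns\<close>

text \<open>The Le condition takes care of all boxes below a \<open>+\<close>, so (ii) has to
  control only those between row \<open>r\<close> and that \<open>+\<close>; (iii) covers the
  columns without a \<open>+\<close> below row \<open>r\<close>.\<close>

lemma good_iff_conditions:
  assumes "c \<in> cols n Dh" "r < c"
  shows "cond_i Dh r c \<or> cond_ii n Dh r c \<or> cond_iii n Dh r c \<longleftrightarrow> c \<in> G (Suc r)"
proof
  assume "cond_i Dh r c \<or> cond_ii n Dh r c \<or> cond_iii n Dh r c"
  then consider "(r, c) \<in> plus Dh"
    | b' where "b' \<in> rows Dh" "r < b'" "(b', c) \<in> plus Dh"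
      "\<And>b. b \<in> rows Dh \<Longrightarrow> r < b \<Longrightarrow> b < b' \<Longrightarrow> unrestricted_zero n Dh b c"
    | "\<And>b. b \<in> rows Dh \<Longrightarrow> r < b \<Longrightarrow> (b, c) \<in> boxes n Dh \<Longrightarrow> unrestricted_zero n Dh b c"
    by (auto simp: cond_i_def cond_ii_def cond_iii_def)
  then have "\<not> restricted_zero n Dh b c" if "r < b" for b
  proof cases
    case 1
    then show ?thesis using no_plus_above that by blast
  next
    case 2
    have "b \<in> rows Dh" if "restricted_zero n Dh b c"
      using that by (auto simp: restricted_zero_def boxes_def)
    moreover have "b \<noteq> b'" if "restricted_zero n Dh b c"
      using that 2 by (auto simp: restricted_zero_def)
    ultimately show ?thesis
      using 2(4)[of b] no_plus_above[of b c b'] 2(3) \<open>r < b\<close>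
      by (metis linorder_neqE_nat restricted_zero_def unrestricted_zero_def)
  next
    case 3
    then show ?thesis using that
      by (auto simp: restricted_zero_def unrestricted_zero_def boxes_def)
  qed
  then show "c \<in> G (Suc r)" using assms by (auto simp: good_cols_iff)
next
  assume G: "c \<in> G (Suc r)"
  have ur: "unrestricted_zero n Dh b c" if "r < b" "(b, c) \<in> boxes n Dh" "(b, c) \<notin> plus Dh" for b
    using that G by (auto simp: unrestricted_zero_def good_cols_iff restricted_zero_def Suc_le_eq)
  show "cond_i Dh r c \<or> cond_ii n Dh r c \<or> cond_iii n Dh r c"
  proof (cases "\<exists>b. r < b \<and> (b, c) \<in> plus Dh")
    case False
    then show ?thesis using ur by (auto simp: cond_iii_def)
  next
    case True
    \<comment> \<open>The topmost \<open>+\<close> below row \<open>r\<close> is the witness for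
      (ii); the boxes above it are zeros, unrestricted by goodness.\<close>
    define b' where "b' = (LEAST b. r < b \<and> (b, c) \<in> plus Dh)"
    have b': "r < b'" "(b', c) \<in> plus Dh" using LeastI_ex[OF True] by (auto simp: b'_def)
    have "unrestricted_zero n Dh b c" if "b \<in> rows Dh" "r < b" "b < b'" for b
    proof (rule ur)
      show "(b, c) \<in> boxes n Dh" using that b' plus_DhD[OF b'(2)] by (auto simp: boxes_def)
      show "(b, c) \<notin> plus Dh"
        using that not_less_Least[of b "\<lambda>b. r < b \<and> (b, c) \<in> plus Dh"] by (auto simp: b'_def)
    qed (use that in simp)
    then have "cond_ii n Dh r c" using b' plus_DhD(1)[OF b'(2)] by (auto simp: cond_ii_def)
    then show ?thesis by blast
  qed
qed

lemma rows_D: "rows D = insert a (rows Dh)"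
  and cols_D: "cols n D = cols n Dh - {a}"
  by (auto simp: D_def algorithm_def Let_def cols_def a_def decorated_perm_of_def)

text \<open>The two ranges of the type (I)/(III) rule merge: a column before the next row
  \<open>W\<close> has no boxes below row \<open>r\<close> and is vacuously good.\<close>

lemma plus_D_iff:
  "(r, c) \<in> plus D \<longleftrightarrow> r \<in> insert a (rows Dh) \<and> c \<in> cols n Dh \<and> c \<noteq> a \<and> r < c \<and>
    (if (r, a) \<in> plus Dh \<and> a < c then (r, c) \<in> plus Dh
     else (r = a \<or> c < L r) \<and> c \<in> G (Suc r))"
proof -
  have a: "perm (decorated_perm_of n Dh) 1 = a" by (simp add: decorated_perm_of_def a_def)
  have typeI: "type_I_plus n Dh a r c \<longleftrightarrow> (r = a \<or> c < L r) \<and> c \<in> G (Suc r)"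
    if c: "c \<in> cols n Dh" "c \<noteq> a" "r < c"
  proof -
    let ?W = "next_row n Dh a r"
    let ?S = "insert (n + 1) {b \<in> insert a (rows Dh). r < b}"
    have fin: "finite ?S" using finite_rows_Dh by simp
    have "?W \<in> ?S" unfolding next_row_def by (rule Min_in[OF fin]) simp
    \<comment> \<open>\<open>W\<close> is a row label of \<open>D\<close> or \<open>n + 1\<close>,
      so no column falls between the ranges \<open>l < W\<close> and \<open>W < l\<close>.\<close>
    then have ne: "?W \<noteq> c" using c by (auto simp: cols_def)
    have W_le: "?W \<le> b" if "b \<in> rows Dh" "r < b" for b
      unfolding next_row_def using fin that by (intro Min_le) auto
    have "c \<in> G (Suc r)" if "c < ?W"
      using that c W_le
      by (fastforce simp: good_cols_iff restricted_zero_def boxes_def Suc_le_eq)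
    moreover have "enat c < leftmost_plus Dh a r \<longleftrightarrow> r = a \<or> c < L r"
      by (simp add: leftmost_plus_def L_def)
    ultimately show ?thesis
      using good_iff_conditions[OF c(1,3)] c ne
      by (auto simp: type_I_plus_def Let_def)
  qed
  have "(r, c) \<in> plus D \<longleftrightarrow> r \<in> insert a (rows Dh) \<and> c \<in> cols n Dh \<and> c \<noteq> a \<and> r < c \<and>
      algorithm_plus n Dh a r c"
    using a by (auto simp: D_def algorithm_def Let_def boxes_def cols_def)
  then show ?thesis using typeI by (auto simp: algorithm_plus_def)
qed

lemma plus_D: "plus D \<subseteq> boxes n D"
  using plus_D_iff by (auto simp: boxes_def rows_D cols_D)

text \<open>A restricted zero of \<open>Dh\<close> spoils its column for every row above it, and a
  type (II) row, where it copies \<open>Dh\<close>, has a zero there as well. This yields both the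
  Le condition for \<open>D\<close> and straight pipes in bad columns.\<close>

lemma no_plus_D_above:
  assumes "r < m" "c \<in> cols n Dh" "m \<le> c" "c \<notin> G m"
  shows "(r, c) \<notin> plus D"
proof -
  from assms obtain b where b: "b \<ge> m" "restricted_zero n Dh b c" by (auto simp: good_cols_iff)
  then have "Suc r \<le> b" using assms by simp
  then have "c \<notin> G (Suc r)" using b(2) unfolding good_cols_iff by blast
  moreover have "(r, c) \<notin> plus Dh" using no_plus_above b assms by force
  ultimately show ?thesis by (auto simp: plus_D_iff)
qed

lemma pipe_up_D_bad:
  assumes "c \<in> cols n Dh" "m \<le> c" "c \<notin> G m"
  shows "pipe_up n D m c = c"
  using assms no_plus_D_above by (intro pipe_up_without_plus[OF plus_D]) blast

text \<open>With a \<open>+\<close> to its left, a zero of \<open>D\<close> can only be due to a bad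
  column: in the copied part of a type (II) row it is a restricted zero of \<open>Dh\<close>,
  elsewhere the bound by \<open>L\<close> holds and goodness must fail.\<close>

lemma le_diagram_D: "le_diagram (k + 1) n D"
proof -
  have False
    if box: "(i, j) \<in> boxes n D" and zero: "(i, j) \<notin> plus D"
      and above: "i' < i" "(i', j) \<in> plus D" and left: "j < j'" "(i, j') \<in> plus D"
    for i j i' j'
  proof -
    have ij: "i \<in> insert a (rows Dh)" "j \<in> cols n Dh" "j \<noteq> a" "i < j"
      using box by (auto simp: boxes_def rows_D cols_D)
    show False
    proof (cases "(i, a) \<in> plus Dh \<and> a < j")
      case True
      then have "restricted_zero n Dh i j"
        using zero left ij plus_DhD(1)[of i a]
        by (auto simp: plus_D_iff restricted_zero_def boxes_def)
      then have "j \<notin> G i" using ij by (auto simp: good_cols_iff)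
      then show False using no_plus_D_above[of i' i j] above ij by simp
    next
      case False
      then have "i = a \<or> j < L i"
        using left le_L[of i j'] by (auto simp: plus_D_iff split: if_splits)
      then have "j \<notin> G (Suc i)" using False zero ij by (auto simp: plus_D_iff)
      then show False using no_plus_D_above[of i' "Suc i" j] above ij by simp
    qed
  qed
  moreover have "card (rows D) = k + 1"
    using card_rows_Dh a_notin_rows finite_rows_Dh by (simp add: rows_D)
  ultimately show ?thesis
    using plus_D rows_Dh a_bounds unfolding le_diagram_def by (fastforce simp: rows_D)
qed

section \<open>Shifting values along the good columns\<close>

text \<open>The value at the cut \<open>m\<close> of \<open>Dh\<close> in the good column following \<open>x\<close> to the left; past the
  last good column one reads \<open>a\<close>.  The pipe dreams of \<open>Dh\<close> and \<open>D\<close> differ by this shift.\<close>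

definition next_val :: "nat \<Rightarrow> nat \<Rightarrow> nat" where
  "next_val m x = (if {g \<in> G m. x < g} = {} then a else pipe_up n Dh m (Min {g \<in> G m. x < g}))"

lemma next_val_eq_pipe_up:
  assumes "g \<in> G m" "x < g" "\<And>g'. g' \<in> G m \<Longrightarrow> x < g' \<Longrightarrow> g \<le> g'"
  shows "next_val m x = pipe_up n Dh m g"
proof -
  have "Min {g \<in> G m. x < g} = g"
    using assms finite_good_cols by (intro Min_eqI) auto
  moreover have "{g \<in> G m. x < g} \<noteq> {}" using assms by blast
  ultimately show ?thesis by (simp only: next_val_def if_False)
qed

lemma next_val_cong:
  assumes "\<And>g. x < g \<Longrightarrow> g \<in> G m \<longleftrightarrow> g \<in> G m'"
    and "\<And>g. x < g \<Longrightarrow> g \<in> G m \<Longrightarrow> pipe_up n Dh m g = pipe_up n Dh m' g"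
  shows "next_val m x = next_val m' x"
proof -
  have eq: "{g \<in> G m. x < g} = {g \<in> G m'. x < g}" using assms(1) by blast
  have "x < Min {g \<in> G m. x < g} \<and> Min {g \<in> G m. x < g} \<in> G m" if "{g \<in> G m. x < g} \<noteq> {}"
    using Min_in[OF _ that] finite_good_cols by auto
  then show ?thesis
    using assms(2) unfolding next_val_def eq[symmetric] by (intro if_cong refl) blast
qed

lemma next_val_Suc_not_row:
  assumes "m \<notin> rows Dh" "m \<le> x"
  shows "next_val (Suc m) x = next_val m x"
proof (rule next_val_cong)
  show "g \<in> G (Suc m) \<longleftrightarrow> g \<in> G m" if "x < g" for g
    using good_cols_not_row[OF assms(1), of g] that assms(2) by auto
  show "pipe_up n Dh (Suc m) g = pipe_up n Dh m g" for g
    using assms(1) plus_DhD(1) by (auto simp: pipe_up_Suc[OF plus_Dh])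
qed

lemma L_good: "r \<in> rows Dh \<Longrightarrow> L r \<in> G (Suc r)"
  using L_plus plus_DhD(3) by (intro plus_good[of r]) (auto simp: Suc_le_eq)

lemma next_plus:
  assumes "r \<in> rows Dh" "x < L r"
  obtains c where "(r, c) \<in> plus Dh" "x < c" "c \<le> L r"
    and "\<And>c'. (r, c') \<in> plus Dh \<Longrightarrow> x < c' \<Longrightarrow> c \<le> c'"
  using Min_plus_in[OF plus_Dh L_plus[OF assms(1)] assms(2)] Min_plus_in(3)[OF plus_Dh] that
  by blast

text \<open>Up to \<open>L r\<close> the good columns at the cut \<open>r\<close> are the
  \<open>+\<close> entries of row \<open>r\<close>, so the next good column is the next
  turn.\<close>

lemma next_val_row:
  assumes "r \<in> rows Dh" "x < L r"
  shows "next_val r x = pipe_left n Dh r x"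
proof -
  obtain c where c: "(r, c) \<in> plus Dh" "x < c" "c \<le> L r"
    and min: "\<And>c'. (r, c') \<in> plus Dh \<Longrightarrow> x < c' \<Longrightarrow> c \<le> c'"
    using next_plus[OF assms] by metis
  have "next_val r x = pipe_up n Dh r c"
  proof (rule next_val_eq_pipe_up)
    show "c \<in> G r" using c good_cols_row[OF assms(1)] by blast
    show "c \<le> g" if "g \<in> G r" "x < g" for g
      using that min c(3) good_cols_row[OF assms(1)] by fastforce
  qed (rule c(2))
  also have "\<dots> = pipe_left n Dh r x"
    using pipe_left_eq_pipe_up[OF plus_Dh c(1,2) min] by simp
  finally show ?thesis .
qed

text \<open>Weakly above row \<open>a\<close> the columns to the left of column \<open>a\<close> carry the same values in \<open>Dh\<close> and
  in \<open>D\<close>; everywhere else the values of \<open>D\<close> are shifted along the good columns.\<close>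

definition same_left_of_a :: "nat \<Rightarrow> bool" where
  "same_left_of_a m \<longleftrightarrow>
     (m \<le> a \<longrightarrow> (\<forall>c\<in>cols n Dh. a < c \<longrightarrow> pipe_up n D m c = pipe_up n Dh m c))"

definition shifted :: "nat \<Rightarrow> bool" where
  "shifted m \<longleftrightarrow>
     (\<forall>c\<in>G m. c \<noteq> a \<longrightarrow> \<not> (m \<le> a \<and> a < c) \<longrightarrow> pipe_up n D m c = next_val m c)"

lemma pipe_left_right_of_plus_a:
  assumes "(r, a) \<in> plus Dh" "same_left_of_a r" "a \<le> x"
  shows "pipe_left n D r x = pipe_left n Dh r x"
proof -
  have eq: "{c. (r, c) \<in> plus D \<and> x < c} = {c. (r, c) \<in> plus Dh \<and> x < c}"
    using assms(1,3) plus_DhD by (auto simp: plus_D_iff)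
  have r: "r \<le> a" using plus_DhD(3)[OF assms(1)] by simp
  show ?thesis
  proof (cases "{c. (r, c) \<in> plus Dh \<and> x < c} = {}")
    case True
    then show ?thesis
      by (simp only: pipe_left_eq[OF plus_D, of r x] pipe_left_eq[OF plus_Dh, of r x] eq simp_thms if_True)
  next
    case False
    let ?c = "Min {c. (r, c) \<in> plus Dh \<and> x < c}"
    have "(r, ?c) \<in> plus Dh" "x < ?c" using False Min_plus_in[OF plus_Dh] by blast+
    then have "pipe_up n D r ?c = pipe_up n Dh r ?c"
      using assms(2,3) r plus_DhD(2) by (simp add: same_left_of_a_def)
    then show ?thesis
      using False
      by (simp only: pipe_left_eq[OF plus_D, of r x] pipe_left_eq[OF plus_Dh, of r x] eq if_False)
  qed
qed

text \<open>At a \<open>+\<close> of \<open>Dh\<close>, the shift present in \<open>D\<close> above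
  row \<open>r\<close> is the move to the next \<open>+\<close> that \<open>Dh\<close> makes in that
  row. A zero here is restricted, and both pipes go straight up.\<close>

lemma pipe_up_D_below:
  assumes r: "r \<in> rows Dh" and sh: "r \<noteq> 1 \<Longrightarrow> shifted r"
    and g: "g \<in> G (Suc r)" "g < L r" "g \<noteq> a" "\<not> (r < a \<and> a < g)"
  shows "pipe_up n D r g = pipe_up n Dh (Suc r) g"
proof (cases "(r, g) \<in> plus Dh")
  case True
  \<comment> \<open>In the top row the rightmost \<open>+\<close> is at \<open>a\<close>, so
    \<open>g\<close> would lie to the left of column \<open>a\<close>.\<close>
  have "r \<noteq> 1"
    using first_row True g(3,4) plus_DhD(1)[OF True] by (metis le_neq_implies_less plus_DhD(3))
  moreover have "g \<in> G r" using True good_cols_row[OF r] by blast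
  moreover have "r \<noteq> a" using r a_notin_rows by blast
  ultimately have "pipe_up n D r g = next_val r g" using sh g(3,4) by (auto simp: shifted_def)
  then show ?thesis
    using True next_val_row[OF r g(2)] by (simp add: pipe_up_Suc[OF plus_Dh])
next
  case False
  then have "g \<notin> G r" using good_cols_row[OF r] g(2) by auto
  moreover have "g \<in> cols n Dh" "r \<le> g" using g(1) by (auto simp: good_cols_iff)
  ultimately show ?thesis
    using False pipe_up_D_bad pipe_up_bad by (simp add: pipe_up_Suc[OF plus_Dh])
qed

text \<open>To the left of \<open>x\<close>, row \<open>a\<close> has a \<open>+\<close> in each
  good column, and the values above it are still unshifted: turning there creates the shift. After
  the last good column the pipe leaves at \<open>a\<close>, the default of
  \<open>next_val\<close>.\<close>

lemma pipe_left_new_row: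
  assumes same: "same_left_of_a a" and x: "a \<le> x"
  shows "pipe_left n D a x = next_val (Suc a) x"
proof -
  have na: "(a, c) \<notin> plus Dh" for c using a_notin_rows plus_DhD(1) by blast
  have eq: "{c. (a, c) \<in> plus D \<and> x < c} = {g \<in> G (Suc a). x < g}"
    using na x by (auto simp: plus_D_iff good_cols_iff)
  have "pipe_up n D a c = pipe_up n Dh (Suc a) c" if "c \<in> G (Suc a)" for c
    using that same na
    by (auto simp: same_left_of_a_def good_cols_iff pipe_up_Suc[OF plus_Dh] Suc_le_eq)
  moreover have "Min {g \<in> G (Suc a). x < g} \<in> G (Suc a)" if "{g \<in> G (Suc a). x < g} \<noteq> {}"
    using Min_in[OF _ that] finite_good_cols by auto
  ultimately show ?thesis
    unfolding next_val_def pipe_left_eq[OF plus_D, of a x] eq by (intro if_cong refl) blast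
qed

lemma pipe_left_old_row:
  assumes r: "r \<in> rows Dh" and same: "same_left_of_a r" and sh: "r \<noteq> 1 \<Longrightarrow> shifted r"
    and x: "r \<le> x" "x < L r" "\<not> (r < a \<and> a \<le> x)"
  shows "pipe_left n D r x = next_val (Suc r) x"
proof -
  let ?A = "{g \<in> G (Suc r). x < g}"
  define g where "g = Min ?A"
  have fin: "finite ?A" using finite_good_cols by simp
  have LA: "L r \<in> ?A" using L_good[OF r] x(2) by simp
  then have gA: "g \<in> G (Suc r)" "x < g" using Min_in[OF fin] by (auto simp: g_def)
  have min: "g \<le> g'" if "g' \<in> G (Suc r)" "x < g'" for g'
    using that fin by (simp add: g_def)
  have gL: "g \<le> L r" using min LA by blast
  have val: "next_val (Suc r) x = pipe_up n Dh (Suc r) g"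
    using next_val_eq_pipe_up[OF gA min] .
  have ra: "r \<noteq> a" using r a_notin_rows by blast
  have g_le_a: "g \<le> a" if "r < a"
    using that x(3) a_good[of "Suc r"] by (intro min) auto
  have plus_min: "g \<le> c" if "(r, c) \<in> plus D" "x < c" for c
    using that min[of c] g_le_a plus_DhD(3)[of r a] by (auto simp: plus_D_iff split: if_splits)
  consider "g = a" | "g = L r" "g \<noteq> a" | "g < L r" "g \<noteq> a" using gL by linarith
  then show ?thesis
  proof cases
    case 1
    \<comment> \<open>\<open>D\<close> has no column \<open>a\<close>: its pipe runs on into the
      part copied from \<open>Dh\<close>, and the pipe of \<open>Dh\<close> in column
      \<open>a\<close> turns into the same part.\<close>
    have "r < a" using gA(1) 1 by (simp add: good_cols_iff)
    then have pa: "(r, a) \<in> plus Dh" using L_less_a[OF r] gL 1 by fastforce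
    have "{c. (r, c) \<in> plus D \<and> x < c} = {c. (r, c) \<in> plus D \<and> a < c}"
      using plus_min 1 gA(2) by (fastforce simp: plus_D_iff)
    then have "pipe_left n D r x = pipe_left n D r a"
      by (simp only: pipe_left_eq[OF plus_D])
    also have "\<dots> = pipe_left n Dh r a"
      using pipe_left_right_of_plus_a[OF pa same] by simp
    also have "\<dots> = pipe_up n Dh (Suc r) a" using pa by (simp add: pipe_up_Suc[OF plus_Dh])
    finally show ?thesis using val 1 by simp
  next
    case 2
    \<comment> \<open>No turn is left in \<open>D\<close>, so its pipe leaves at \<open>r\<close>,
      like the pipe that \<open>Dh\<close> turns at its leftmost \<open>+\<close>. A type (II) row
      would force \<open>a \<le> L r = g \<le> a\<close>.\<close>
    have "(r, c) \<notin> plus D" if "x < c" for c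
    proof
      assume c: "(r, c) \<in> plus D"
      then have "L r \<le> c" using plus_min that 2 by blast
      then have "(r, a) \<in> plus Dh" using c ra by (auto simp: plus_D_iff split: if_splits)
      then show False using g_le_a le_L 2 plus_DhD(3) by fastforce
    qed
    then have "pipe_left n D r x = r" using pipe_left_eq_row[OF plus_D] by blast
    moreover have "pipe_left n Dh r (L r) = r"
      using le_L by (intro pipe_left_eq_row[OF plus_Dh]) fastforce
    ultimately show ?thesis
      using val 2 L_plus[OF r] by (simp add: pipe_up_Suc[OF plus_Dh])
  next
    case 3
    have nra: "\<not> (r < a \<and> a < g)" using g_le_a by fastforce
    have "(r, g) \<in> plus D"
      using 3 gA r nra plus_DhD(3)[of r a] by (auto simp: plus_D_iff good_cols_iff)
    then have "pipe_left n D r x = pipe_up n D r g"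
      using pipe_left_eq_pipe_up[OF plus_D _ gA(2) plus_min] by blast
    then show ?thesis using pipe_up_D_below[OF r sh gA(1) 3 nra] val by simp
  qed
qed

lemma pipe_left_D:
  assumes "r \<in> rows D" "same_left_of_a r" "r \<noteq> 1 \<Longrightarrow> shifted r"
    and "r \<le> x" "r = a \<or> x < L r" "\<not> (r < a \<and> a \<le> x)"
  shows "pipe_left n D r x = next_val (Suc r) x"
proof (cases "r = a")
  case True
  then show ?thesis using pipe_left_new_row assms by simp
next
  case False
  then show ?thesis using assms by (intro pipe_left_old_row) (auto simp: rows_D)
qed

section \<open>Induction over the cuts\<close>

lemma invariant_step_not_row:
  assumes m: "m \<notin> rows D" and same: "same_left_of_a m" and sh: "shifted m"
  shows "same_left_of_a (Suc m)" "shifted (Suc m)"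
proof -
  have mR: "m \<notin> rows Dh" "m \<noteq> a" using m by (auto simp: rows_D)
  have D: "pipe_up n D (Suc m) c = pipe_up n D m c" for c
    using m plus_D by (auto simp: pipe_up_Suc[OF plus_D] boxes_def)
  have Dh: "pipe_up n Dh (Suc m) c = pipe_up n Dh m c" for c
    using mR(1) plus_DhD(1) by (auto simp: pipe_up_Suc[OF plus_Dh])
  show "same_left_of_a (Suc m)" using same by (simp add: same_left_of_a_def D Dh)
  have "c \<in> G m \<and> next_val (Suc m) c = next_val m c" if "c \<in> G (Suc m)" for c
    using that good_cols_not_row[OF mR(1)] next_val_Suc_not_row[OF mR(1), of c] good_cols_iff[of c "Suc m"]
    by simp
  \<comment> \<open>The exempt region \<open>m \<le> a \<and> a < c\<close> changes only when
    \<open>m\<close> passes \<open>a\<close>, which is a row of \<open>D\<close>.\<close>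
  then show "shifted (Suc m)"
    using sh mR(2) unfolding shifted_def D by (metis Suc_leI le_neq_implies_less)
qed

text \<open>Left of column \<open>a\<close>, a row above row \<open>a\<close> is either copied or
  empty in both diagrams. Elsewhere a good column with \<open>c < L r\<close>, or any good column in
  row \<open>a\<close>, turns in \<open>D\<close>; from \<open>L r\<close> on it goes straight and
  its successors do not change.\<close>

lemma invariant_step_row:
  assumes r: "r \<in> rows D" and same: "same_left_of_a r" and sh: "r \<noteq> 1 \<Longrightarrow> shifted r"
  shows "same_left_of_a (Suc r)" "shifted (Suc r)"
proof -
  show "same_left_of_a (Suc r)"
    unfolding same_left_of_a_def
  proof (intro impI ballI)
    fix c assume "Suc r \<le> a" and c: "c \<in> cols n Dh" "a < c"
    then have rR: "r \<in> rows Dh" "r < a" using r by (auto simp: rows_D)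
    then have eq: "pipe_up n D r c = pipe_up n Dh r c"
      using same c by (simp add: same_left_of_a_def)
    show "pipe_up n D (Suc r) c = pipe_up n Dh (Suc r) c"
    proof (cases "(r, a) \<in> plus Dh")
      case True
      have "(r, c) \<in> plus D \<longleftrightarrow> (r, c) \<in> plus Dh" using True rR c by (auto simp: plus_D_iff)
      then show ?thesis
        using eq c pipe_left_right_of_plus_a[OF True same, of c]
        by (simp add: pipe_up_Suc[OF plus_D] pipe_up_Suc[OF plus_Dh])
    next
      case False
      then have "L r < c" using L_less_a[OF rR] c by simp
      then have "(r, c) \<notin> plus D" "(r, c) \<notin> plus Dh"
        using False rR le_L[of r c] by (auto simp: plus_D_iff)
      then show ?thesis using eq by (simp add: pipe_up_Suc[OF plus_D] pipe_up_Suc[OF plus_Dh])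
    qed
  qed
  show "shifted (Suc r)"
    unfolding shifted_def
  proof (intro ballI impI)
    fix c assume c: "c \<in> G (Suc r)" "c \<noteq> a" "\<not> (Suc r \<le> a \<and> a < c)"
    have rc: "c \<in> cols n Dh" "r < c" using c(1) by (auto simp: good_cols_iff)
    have else_rule: "\<not> ((r, a) \<in> plus Dh \<and> a < c)" using plus_DhD(3)[of r a] c(3) by auto
    have plus_iff: "(r, c) \<in> plus D \<longleftrightarrow> r = a \<or> c < L r"
      using r rc c(1,2) else_rule by (auto simp: plus_D_iff rows_D)
    show "pipe_up n D (Suc r) c = next_val (Suc r) c"
    proof (cases "(r, c) \<in> plus D")
      case True
      then have "pipe_left n D r c = next_val (Suc r) c"
        using r same sh rc(2) plus_iff c(2,3) by (intro pipe_left_D) auto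
      then show ?thesis using True by (simp add: pipe_up_Suc[OF plus_D])
    next
      case False
      then have ra: "r \<noteq> a" and Lc: "L r \<le> c" using plus_iff by auto
      have rR: "r \<in> rows Dh" using r ra by (simp add: rows_D)
      have "r \<noteq> 1"
        using first_row ra Lc le_L[of 1 a] c(2,3) rR plus_DhD(3)[of 1 a] by auto
      have "c \<in> G r" using good_cols_row[OF rR] L_plus[OF rR] c(1) Lc by (metis le_neq_implies_less)
      moreover have "\<not> (r \<le> a \<and> a < c)" using c(3) ra by auto
      ultimately have "pipe_up n D r c = next_val r c"
        using sh[OF \<open>r \<noteq> 1\<close>] c(2) by (simp add: shifted_def)
      also have "\<dots> = next_val (Suc r) c"
      proof (rule next_val_cong)
        fix g assume "c < g"
        then have g: "L r < g" "(r, g) \<notin> plus Dh" using Lc le_L[of r g] by auto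
        show "g \<in> G r \<longleftrightarrow> g \<in> G (Suc r)" using g good_cols_row[OF rR] by blast
        show "pipe_up n Dh r g = pipe_up n Dh (Suc r) g"
          using g by (simp add: pipe_up_Suc[OF plus_Dh])
      qed
      finally show ?thesis using False by (simp add: pipe_up_Suc[OF plus_D])
    qed
  qed
qed

lemma one_row_D: "1 \<in> rows D"
  using first_row by (auto simp: rows_D)

text \<open>The shift is asserted from the cut 2 on; label 1 is a row of \<open>D\<close>, and
  crossing it establishes \<open>shifted\<close>.\<close>

lemma invariant: "same_left_of_a (Suc m) \<and> (m \<noteq> 0 \<longrightarrow> shifted (Suc m))"
proof (induction m)
  case 0
  have "(0, c) \<notin> plus D" "(0, c) \<notin> plus Dh" for c
    using plus_DhD(4)[of 0] rows_Dh a_bounds by (auto simp: plus_D_iff)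
  then show ?case
    by (simp add: same_left_of_a_def pipe_up_Suc[OF plus_D] pipe_up_Suc[OF plus_Dh] pipe_up_0)
next
  case (Suc m)
  show ?case
  proof (cases "Suc m \<in> rows D")
    case True
    then show ?thesis using invariant_step_row[OF True] Suc by simp
  next
    case False
    then have "m \<noteq> 0" using one_row_D by (cases m) auto
    then show ?thesis using invariant_step_not_row[OF False] Suc by simp
  qed
qed

section \<open>Reading off the permutation of \<open>D\<close>\<close>

lemma diagram_perm_D_next_val:
  assumes "i \<in> {1..n}"
  shows "diagram_perm n D i = next_val (Suc i) i"
proof -
  have same: "same_left_of_a i" and sh: "i \<noteq> 1 \<Longrightarrow> shifted i"
    using invariant[of "i - 1"] assms by auto
  show ?thesis
  proof (cases "i \<in> rows D")
    case True
    have "i = a \<or> i < L i" using True L_plus plus_DhD(3) by (auto simp: rows_D)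
    then show ?thesis
      using True pipe_left_D[OF True same sh] by (simp add: diagram_perm_def)
  next
    case False
    then have i: "i \<notin> rows Dh" "i \<noteq> a" "i \<in> cols n Dh" "i \<in> cols n D"
      using assms by (auto simp: rows_D cols_def)
    have "i \<noteq> 1" using False one_row_D by blast
    moreover have "i \<in> G i" using good_cols_not_row[OF i(1)] i(3) by blast
    ultimately have "pipe_up n D i i = next_val i i"
      using sh i(2) by (auto simp: shifted_def)
    then show ?thesis
      using False i next_val_Suc_not_row[OF i(1), of i] by (simp add: diagram_perm_def)
  qed
qed

text \<open>The first good column after \<open>i\<close> is \<open>Suc i\<close> itself if that is a
  column, and otherwise the first \<open>+\<close> of row \<open>Suc i\<close>; in both cases it is
  where the pipe of \<open>Dh\<close> from step \<open>Suc i\<close> goes up.\<close>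

lemma next_val_eq_diagram_perm_Dh:
  assumes "i < n"
  shows "next_val (Suc i) i = diagram_perm n Dh (Suc i)"
proof (cases "Suc i \<in> rows Dh")
  case True
  have L: "Suc i < L (Suc i)" using L_plus[OF True] plus_DhD(3) by blast
  have "{g \<in> G (Suc i). i < g} = {g \<in> G (Suc i). Suc i < g}"
    using True by (auto simp: good_cols_iff cols_def intro!: Suc_lessI)
  then have "next_val (Suc i) i = next_val (Suc i) (Suc i)" by (simp only: next_val_def)
  then show ?thesis using True next_val_row[OF True L] by (simp add: diagram_perm_def)
next
  case False
  then have c: "Suc i \<in> cols n Dh" using assms by (simp add: cols_def)
  then have "Suc i \<in> G (Suc i)" using good_cols_not_row[OF False] by blast
  then have "next_val (Suc i) i = pipe_up n Dh (Suc i) (Suc i)"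
    by (intro next_val_eq_pipe_up) auto
  then show ?thesis using False c by (simp add: diagram_perm_def)
qed

text \<open>Past the last step no column remains, and the default value closes the cyclic shift of
  the one-line notation.\<close>

lemma next_val_last: "next_val (Suc n) n = a"
  by (auto simp: next_val_def good_cols_iff cols_def)

lemma diagram_perm_D:
  assumes "i \<in> {1..n}"
  shows "diagram_perm n D i = (if i = n then a else diagram_perm n Dh (Suc i))"
  using diagram_perm_D_next_val[OF assms] next_val_eq_diagram_perm_Dh[of i] next_val_last assms
  by auto

text \<open>If \<open>i < n\<close> is fixed, the pipe of \<open>Dh\<close> from
  \<open>i + 1\<close> leaves at the smaller label \<open>i\<close>, which must be a row label;
  \<open>n\<close> is fixed only if \<open>n = a\<close>.\<close>

lemma loopless_D: "loops n (decorated_perm_of n D) = {}"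
proof -
  have "i \<in> rows D" if i: "i \<in> {1..n}" "diagram_perm n D i = i" for i
  proof (cases "i = n")
    case True
    then show ?thesis using i diagram_perm_D[of i] by (simp add: rows_D)
  next
    case False
    then have "diagram_perm n Dh (Suc i) = i" "Suc i \<in> {1..n}"
      using i diagram_perm_D[of i] by auto
    then have "i \<in> rows Dh" using diagram_perm_exit_col[OF plus_Dh, of "Suc i"] by fastforce
    then show ?thesis by (simp add: rows_D)
  qed
  then show ?thesis by (auto simp: loops_def decorated_perm_of_def)
qed

end

theorem mainTheorem11:
  fixes k n :: nat and Dh D :: diagram and a :: "nat \<Rightarrow> nat"
  assumes "n \<ge> 1"
    and "le_diagram k n Dh"
    and "coloops (decorated_perm_of n Dh) = {}"
    and "perm (decorated_perm_of n Dh) 1 = a n"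
    and "\<And>i. 2 \<le> i \<Longrightarrow> i \<le> n \<Longrightarrow> perm (decorated_perm_of n Dh) i = a (i - 1)"
    and "D = algorithm n Dh"
  shows "le_diagram (k + 1) n D
    \<and> is_decorated_perm n (decorated_perm_of n D)
    \<and> (\<forall>i\<in>{1..n}. perm (decorated_perm_of n D) i = a i)
    \<and> loops n (decorated_perm_of n D) = {}
    \<and> card (anti_excedances n (decorated_perm_of n D)) = k + 1"
proof -
  interpret dh: coloopless_le_diagram k n Dh
    using assms by unfold_locales
  have D: "D = dh.D" by (simp add: dh.D_def assms(6))
  have le: "le_diagram (k + 1) n D" using dh.le_diagram_D D by simp
  then have rows: "rows D \<subseteq> {1..n}" and card: "card (rows D) = k + 1"
    and plus: "plus D \<subseteq> boxes n D"
    unfolding le_diagram_def by blast+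
  have "is_decorated_perm n (decorated_perm_of n D)"
    using diagram_perm_permutes[OF plus rows] rows
    by (auto simp: is_decorated_perm_def decorated_perm_of_def)
  moreover have "perm (decorated_perm_of n D) i = a i" if "i \<in> {1..n}" for i
    using dh.diagram_perm_D[OF that] assms(4) assms(5)[of "Suc i"] that
    by (auto simp: D decorated_perm_of_def dh.a_def)
  moreover have "loops n (decorated_perm_of n D) = {}" using dh.loopless_D D by simp
  moreover have "card (anti_excedances n (decorated_perm_of n D)) = k + 1"
    using anti_excedances_decorated_perm_of[OF plus rows] card by simp
  ultimately show ?thesis using le by blast
qed

end
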